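(* Suppose the matrix $A(t)=A(t;\boldsymbol\theta)\in\mathbb{R}^{2N\times 2N}$ has the structure $$A(t)=A_d+\sum_{j=1}^{N_C}c_j(t)A_{c,j},\qquad c_j(t)=\sum_{k=1}^{n_j}\theta_{j,k}\,c_{j,k}(t),\qquad \sum_{j=1}^{N_C}n_j=N_P,$$ where $A_d,A_{c,1},\dots,A_{c,N_C}$ are constant matrices, the $c_{j,k}$ are given (sufficiently smooth) scalar functions of $t$, and $\boldsymbol\theta=(\theta_{j,k})\in\mathbb{R}^{N_P}$ is the vector of control parameters, also indexed as $\theta_1,\dots,\theta_{N_P}$. Then the gradient accumulation $$\frac{d\mathcal{J}}{d\theta_k}=-\sum_{n=0}^{N_T-1}\left\langle\frac{\partial L_{n+1,q}}{\partial\theta_k}\mathbf{w}_{n+1}+\frac{\partial R_{n,p}}{\partial\theta_k}\mathbf{w}_n,\ \boldsymbol\lambda_{n+1}\right\rangle,\qquad k=1,\dots,N_P,$$ i.e. the computation of the right-hand sides for all $k=1,\dots,N_P$ from given vectors $\mathbf{w}_0,\dots,\mathbf{w}_{N_T},\boldsymbol\lambda_1,\dots,\boldsymbol\lambda_{N_T}\in\mathbb{R}^{2N}$, can be rewritten so that the total number of matrix-vector multiplications required is independent of the number of control parameters $N_P$. That is, for fixed $N,N_T,N_C,p,q$ there is a number $M$, not depending on $N_P$, such that all $N_P$ values can be computed using at most $M$ matrix-vector multiplications.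
   Context: Setting. $N,N_C,N_P,N_T\ge1$ are integers, $T>0$, $\Delta t=T/N_T$, $t_n=n\Delta t$. The system is $\frac{d}{dt}\mathbf{w}=A(t;\boldsymbol\theta)\mathbf{w}$ on $\mathbb{R}^{2N}$ (the real form of Schrödinger's equation on $\mathbb{C}^N$). $N_C$ is the number of control pulses $c_j(t)$ and $N_P$ the total number of control parameters. Hermite Runge-Kutta matrices. Fix nonnegative integers $p,q$ with $p+q\ge1$. Write $A_n^{(j)}=\frac{d^jA}{dt^j}(t_n;\boldsymbol\theta)$. Define $$D_{n,0}=I,\qquad D_{n,j+1}=\sum_{i=0}^{j}\binom{j}{i}A_n^{(j-i)}D_{n,i},$$ $$c_j^{pq}=\binom{p}{j}\Big/\binom{p+q}{j},\qquad c_j^{qp}=\binom{q}{j}\Big/\binom{p+q}{j},$$ $$L_{n,q}=-\sum_{j=1}^{q}(-1)^jc_j^{qp}\frac{1}{j!}\Delta t^jD_{n,j},\qquad R_{n,p}=\sum_{j=1}^{p}c_j^{pq}\frac{1}{j!}\Delta t^jD_{n,j}.$$ (The doubly superscripted numbers $c_j^{pq}$ are method coefficients, unrelated to the control pulses $c_j(t)$.) The derivatives $\partial L_{n,q}/\partial\theta_k$, $\partial R_{n,p}/\partial\theta_k$ are entrywise, and $\langle\cdot,\cdot\rangle$ is the Euclidean dot product. Cost convention. A matrix-vector multiplication is the product of one of the $2N\times 2N$ matrices $A_n^{(i)}$, $\partial A_n^{(i)}/\partial\theta_k$, $A_d$, $A_{c,j}$, or the transpose of one of these, with a vector in $\mathbb{R}^{2N}$.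 Only these are counted; inner products and linear combinations of vectors, scalar arithmetic, and evaluations of the control functions, their time derivatives, and the derivatives of these with respect to the control parameters (such as $\partial c_j^{(i)}(t_n)/\partial\theta_k$, where $c_j^{(i)}=d^ic_j/dt^i$) are not counted. Role of the vectors. In the application, $\mathbf{w}_n$ are the states of the Hermite Runge-Kutta scheme $\mathbf{w}_{n+1}-L_{n+1,q}\mathbf{w}_{n+1}=\mathbf{w}_n+R_{n,p}\mathbf{w}_n$, $\mathcal{J}$ is a discrete objective function $\sum_{n=0}^{N_T}\mathfrak{j}_n(\mathbf{w}_n)$, and $\boldsymbol\lambda_n$ are the adjoint vectors for which the displayed formula gives $d\mathcal{J}/d\theta_k$; for the present statement the $\mathbf{w}_n$ and $\boldsymbol\lambda_n$ are simply given. *)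

theory Defs
  imports "HOL-Analysis.Analysis"
begin

text \<open>
  Time derivatives are taken within \<^term>\<open>{0..T}\<close>, hence are one-sided at the two end points,
  so that the functions involved only matter on the time interval.
\<close>

fun time_deriv :: "real \<Rightarrow> nat \<Rightarrow> (real \<Rightarrow> 'a::real_normed_vector) \<Rightarrow> real \<Rightarrow> 'a" where
  "time_deriv T 0 f = f"
| "time_deriv T (Suc i) f = (\<lambda>t. vector_derivative (time_deriv T i f) (at t within {0..T}))"

definition times_differentiable :: "real \<Rightarrow> nat \<Rightarrow> (real \<Rightarrow> real) \<Rightarrow> bool" where
  "times_differentiable T m f \<longleftrightarrow>
     (\<forall>i<m. \<forall>t\<in>{0..T}. time_deriv T i f differentiable (at t within {0..T}))"

definition time_step :: "real \<Rightarrow> nat \<Rightarrow> real" where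
  "time_step T NT = T / real NT"

definition grid_time :: "real \<Rightarrow> nat \<Rightarrow> nat \<Rightarrow> real" where
  "grid_time T NT n = real n * time_step T NT"

definition scalar_pderiv :: "(('k \<Rightarrow> real) \<Rightarrow> real) \<Rightarrow> ('k \<Rightarrow> real) \<Rightarrow> 'k \<Rightarrow> real" where
  "scalar_pderiv f \<theta> k = deriv (\<lambda>x. f (\<theta>(k := x))) (\<theta> k)"

definition matrix_pderiv ::
  "(('k \<Rightarrow> real) \<Rightarrow> real^'m^'m) \<Rightarrow> ('k \<Rightarrow> real) \<Rightarrow> 'k \<Rightarrow> real^'m^'m" where
  "matrix_pderiv F \<theta> k = (\<chi> r s. scalar_pderiv (\<lambda>\<theta>'. F \<theta>' $ r $ s) \<theta> k)"


section \<open>Hermite Runge-Kutta matrices\<close>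

fun hrk_D :: "real \<Rightarrow> (real \<Rightarrow> real^'m^'m) \<Rightarrow> real \<Rightarrow> nat \<Rightarrow> real^'m^'m" where
  "hrk_D T A t 0 = mat 1"
| "hrk_D T A t (Suc j) =
     (\<Sum>i\<le>j. real (j choose i) *\<^sub>R (time_deriv T (j - i) A t ** hrk_D T A t i))"

definition hrk_coeff :: "nat \<Rightarrow> nat \<Rightarrow> nat \<Rightarrow> real" where
  "hrk_coeff p q j = real (p choose j) / real ((p + q) choose j)"

definition hrk_L ::
  "nat \<Rightarrow> nat \<Rightarrow> real \<Rightarrow> nat \<Rightarrow> (real \<Rightarrow> real^'m^'m) \<Rightarrow> nat \<Rightarrow> real^'m^'m" where
  "hrk_L p q T NT A n =
     - (\<Sum>j=1..q. ((-1) ^ j * hrk_coeff q p j * (1 / fact j) * time_step T NT ^ j) *\<^sub>R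
          hrk_D T A (grid_time T NT n) j)"

definition hrk_R ::
  "nat \<Rightarrow> nat \<Rightarrow> real \<Rightarrow> nat \<Rightarrow> (real \<Rightarrow> real^'m^'m) \<Rightarrow> nat \<Rightarrow> real^'m^'m" where
  "hrk_R p q T NT A n =
     (\<Sum>j=1..p. (hrk_coeff p q j * (1 / fact j) * time_step T NT ^ j) *\<^sub>R
          hrk_D T A (grid_time T NT n) j)"

definition gradient_accumulation ::
  "nat \<Rightarrow> nat \<Rightarrow> real \<Rightarrow> nat \<Rightarrow> (('k \<Rightarrow> real) \<Rightarrow> real \<Rightarrow> real^'m^'m) \<Rightarrow> ('k \<Rightarrow> real) \<Rightarrow>
     (nat \<Rightarrow> real^'m) \<Rightarrow> (nat \<Rightarrow> real^'m) \<Rightarrow> 'k \<Rightarrow> real" where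
  "gradient_accumulation p q T NT A \<theta> w lam k =
     - (\<Sum>n=0..NT - 1.
          (matrix_pderiv (\<lambda>\<theta>'. hrk_L p q T NT (A \<theta>') (n + 1)) \<theta> k *v w (n + 1)
           + matrix_pderiv (\<lambda>\<theta>'. hrk_R p q T NT (A \<theta>') n) \<theta> k *v w n) \<bullet> lam (n + 1))"


section \<open>Control systems\<close>

text \<open>
  Pulse \<open>j\<close> has \<open>nj j\<close> parameters; the parameter vector is indexed by the pairs \<open>(j, k)\<close> with
  \<open>1 \<le> j \<le> NC\<close> and \<open>1 \<le> k \<le> nj j\<close>, and no other argument of \<open>\<theta>\<close> is used.
\<close>

definition control_pulse ::
  "(nat \<Rightarrow> nat) \<Rightarrow> (nat \<Rightarrow> nat \<Rightarrow> real \<Rightarrow> real) \<Rightarrow> (nat \<times> nat \<Rightarrow> real) \<Rightarrow> nat \<Rightarrow> real \<Rightarrow> real" where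
  "control_pulse nj c \<theta> j t = (\<Sum>k=1..nj j. \<theta> (j, k) * c j k t)"

definition system_matrix ::
  "nat \<Rightarrow> (nat \<Rightarrow> nat) \<Rightarrow> real^'m^'m \<Rightarrow> (nat \<Rightarrow> real^'m^'m) \<Rightarrow> (nat \<Rightarrow> nat \<Rightarrow> real \<Rightarrow> real) \<Rightarrow>
     (nat \<times> nat \<Rightarrow> real) \<Rightarrow> real \<Rightarrow> real^'m^'m" where
  "system_matrix NC nj Ad Ac c \<theta> t = Ad + (\<Sum>j=1..NC. control_pulse nj c \<theta> j t *\<^sub>R Ac j)"


section \<open>Straight-line programs and their cost\<close>

text \<open>
  A program is a list of instructions acting on scalar and vector registers, all of which
  initially hold zero.  The first argument of an instruction is its target register.  Matrices are
  accessible only through products with vectors, and the only vectors a program can read are the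
  given \<open>w\<^sub>n\<close> and \<open>\<lambda>\<^sub>n\<close>; in particular neither matrix entries nor unit vectors are available.

  The natural numbers in the names of input quantities are to be read as follows:
  \<open>Sys_Deriv i n\<close> is the \<open>i\<close>-th time derivative of the system matrix at time \<open>t\<^sub>n\<close>,
  \<open>Sys_Param_Deriv i n k\<close> its partial derivative with respect to \<open>\<theta>\<^sub>k\<close>,
  \<open>Load_Pulse d j i n\<close> reads the \<open>i\<close>-th time derivative of pulse \<open>j\<close> at \<open>t\<^sub>n\<close>,
  and \<open>Load_Pulse_Deriv d j i n k\<close> its partial derivative with respect to \<open>\<theta>\<^sub>k\<close>.
  Here \<open>k\<close> is the flat parameter index in \<open>{1..NP}\<close>.
\<close>

datatype matrix_ref =
    Drift
  | Control nat
  | Sys_Deriv nat nat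
  | Sys_Param_Deriv nat nat nat

datatype instr =
    Load_Const nat real
  | Load_Step nat
  | Load_Param nat nat
  | Load_Pulse nat nat nat nat
  | Load_Pulse_Deriv nat nat nat nat nat
  | Scalar_Add nat nat nat
  | Scalar_Diff nat nat nat
  | Scalar_Mult nat nat nat
  | Scalar_Div nat nat nat
  | Inner_Prod nat nat nat
  | Load_State nat nat
  | Load_Adjoint nat nat
  | Vec_Add nat nat nat
  | Vec_Scale nat nat nat
  | Mat_Vec nat matrix_ref nat
  | Mat_Transpose_Vec nat matrix_ref nat

record ('m::finite) inputs =
  in_step :: real
  in_param :: "nat \<Rightarrow> real"
  in_pulse :: "nat \<Rightarrow> nat \<Rightarrow> nat \<Rightarrow> real"
  in_pulse_deriv :: "nat \<Rightarrow> nat \<Rightarrow> nat \<Rightarrow> nat \<Rightarrow> real"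
  in_matrix :: "matrix_ref \<Rightarrow> real^'m^'m"
  in_state :: "nat \<Rightarrow> real^'m"
  in_adjoint :: "nat \<Rightarrow> real^'m"

fun exec_instr ::
  "('m::finite) inputs \<Rightarrow> instr \<Rightarrow> (nat \<Rightarrow> real) \<times> (nat \<Rightarrow> real^'m) \<Rightarrow>
     (nat \<Rightarrow> real) \<times> (nat \<Rightarrow> real^'m)" where
  "exec_instr D (Load_Const d r) (s, v) = (s(d := r), v)"
| "exec_instr D (Load_Step d) (s, v) = (s(d := in_step D), v)"
| "exec_instr D (Load_Param d k) (s, v) = (s(d := in_param D k), v)"
| "exec_instr D (Load_Pulse d j i n) (s, v) = (s(d := in_pulse D j i n), v)"
| "exec_instr D (Load_Pulse_Deriv d j i n k) (s, v) = (s(d := in_pulse_deriv D j i n k), v)"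
| "exec_instr D (Scalar_Add d a b) (s, v) = (s(d := s a + s b), v)"
| "exec_instr D (Scalar_Diff d a b) (s, v) = (s(d := s a - s b), v)"
| "exec_instr D (Scalar_Mult d a b) (s, v) = (s(d := s a * s b), v)"
| "exec_instr D (Scalar_Div d a b) (s, v) = (s(d := s a / s b), v)"
| "exec_instr D (Inner_Prod d x y) (s, v) = (s(d := v x \<bullet> v y), v)"
| "exec_instr D (Load_State d n) (s, v) = (s, v(d := in_state D n))"
| "exec_instr D (Load_Adjoint d n) (s, v) = (s, v(d := in_adjoint D n))"
| "exec_instr D (Vec_Add d x y) (s, v) = (s, v(d := v x + v y))"
| "exec_instr D (Vec_Scale d a x) (s, v) = (s, v(d := s a *\<^sub>R v x))"
| "exec_instr D (Mat_Vec d X x) (s, v) = (s, v(d := in_matrix D X *v v x))"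
| "exec_instr D (Mat_Transpose_Vec d X x) (s, v) =
     (s, v(d := transpose (in_matrix D X) *v v x))"

definition run :: "('m::finite) inputs \<Rightarrow> instr list \<Rightarrow> (nat \<Rightarrow> real) \<times> (nat \<Rightarrow> real^'m)" where
  "run D P = fold (exec_instr D) P (\<lambda>_. 0, \<lambda>_. 0)"

text \<open>The \<open>k\<close>-th output of a program is the final content of scalar register \<open>k\<close>.\<close>

definition program_output :: "('m::finite) inputs \<Rightarrow> instr list \<Rightarrow> nat \<Rightarrow> real" where
  "program_output D P k = fst (run D P) k"

fun is_matvec :: "instr \<Rightarrow> bool" where
  "is_matvec (Mat_Vec d X x) = True"
| "is_matvec (Mat_Transpose_Vec d X x) = True"
| "is_matvec _ = False"

definition matvec_count :: "instr list \<Rightarrow> nat" where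
  "matvec_count P = length (filter is_matvec P)"

text \<open>
  Programs may only refer to quantities that are part of the input.  The matrices \<open>D\<^sub>n\<^sub>,\<^sub>j\<close> with
  \<open>j \<le> max p q\<close> involve time derivatives of order less than \<open>max p q\<close> only.
\<close>

fun valid_matrix_ref :: "nat \<Rightarrow> nat \<Rightarrow> nat \<Rightarrow> nat \<Rightarrow> nat \<Rightarrow> matrix_ref \<Rightarrow> bool" where
  "valid_matrix_ref p q NT NC NP Drift \<longleftrightarrow> True"
| "valid_matrix_ref p q NT NC NP (Control j) \<longleftrightarrow> j \<in> {1..NC}"
| "valid_matrix_ref p q NT NC NP (Sys_Deriv i n) \<longleftrightarrow> i < max p q \<and> n \<le> NT"
| "valid_matrix_ref p q NT NC NP (Sys_Param_Deriv i n k) \<longleftrightarrow>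
     i < max p q \<and> n \<le> NT \<and> k \<in> {1..NP}"

fun valid_instr :: "nat \<Rightarrow> nat \<Rightarrow> nat \<Rightarrow> nat \<Rightarrow> nat \<Rightarrow> instr \<Rightarrow> bool" where
  "valid_instr p q NT NC NP (Load_Param d k) \<longleftrightarrow> k \<in> {1..NP}"
| "valid_instr p q NT NC NP (Load_Pulse d j i n) \<longleftrightarrow> j \<in> {1..NC} \<and> i < max p q \<and> n \<le> NT"
| "valid_instr p q NT NC NP (Load_Pulse_Deriv d j i n k) \<longleftrightarrow>
     j \<in> {1..NC} \<and> i < max p q \<and> n \<le> NT \<and> k \<in> {1..NP}"
| "valid_instr p q NT NC NP (Load_State d n) \<longleftrightarrow> n \<le> NT"
| "valid_instr p q NT NC NP (Load_Adjoint d n) \<longleftrightarrow> n \<in> {1..NT}"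
| "valid_instr p q NT NC NP (Mat_Vec d X x) \<longleftrightarrow> valid_matrix_ref p q NT NC NP X"
| "valid_instr p q NT NC NP (Mat_Transpose_Vec d X x) \<longleftrightarrow> valid_matrix_ref p q NT NC NP X"
| "valid_instr p q NT NC NP _ \<longleftrightarrow> True"

definition valid_program :: "nat \<Rightarrow> nat \<Rightarrow> nat \<Rightarrow> nat \<Rightarrow> nat \<Rightarrow> instr list \<Rightarrow> bool" where
  "valid_program p q NT NC NP P \<longleftrightarrow> (\<forall>I\<in>set P. valid_instr p q NT NC NP I)"

text \<open>Here \<open>e\<close> maps a flat parameter index to the corresponding pair \<open>(j, k)\<close>.\<close>

fun control_matrix ::
  "real \<Rightarrow> nat \<Rightarrow> nat \<Rightarrow> (nat \<Rightarrow> nat) \<Rightarrow> (nat \<Rightarrow> nat \<times> nat) \<Rightarrow> real^'m^'m \<Rightarrow> (nat \<Rightarrow> real^'m^'m) \<Rightarrow>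
     (nat \<Rightarrow> nat \<Rightarrow> real \<Rightarrow> real) \<Rightarrow> (nat \<times> nat \<Rightarrow> real) \<Rightarrow> matrix_ref \<Rightarrow> real^'m^'m" where
  "control_matrix T NT NC nj e Ad Ac c \<theta> Drift = Ad"
| "control_matrix T NT NC nj e Ad Ac c \<theta> (Control j) = Ac j"
| "control_matrix T NT NC nj e Ad Ac c \<theta> (Sys_Deriv i n) =
     time_deriv T i (system_matrix NC nj Ad Ac c \<theta>) (grid_time T NT n)"
| "control_matrix T NT NC nj e Ad Ac c \<theta> (Sys_Param_Deriv i n k) =
     matrix_pderiv (\<lambda>\<theta>'. time_deriv T i (system_matrix NC nj Ad Ac c \<theta>') (grid_time T NT n))
       \<theta> (e k)"

definition control_inputs ::
  "real \<Rightarrow> nat \<Rightarrow> nat \<Rightarrow> (nat \<Rightarrow> nat) \<Rightarrow> (nat \<Rightarrow> nat \<times> nat) \<Rightarrow> real^'m^'m \<Rightarrow> (nat \<Rightarrow> real^'m^'m) \<Rightarrow>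
     (nat \<Rightarrow> nat \<Rightarrow> real \<Rightarrow> real) \<Rightarrow> (nat \<times> nat \<Rightarrow> real) \<Rightarrow> (nat \<Rightarrow> real^'m) \<Rightarrow> (nat \<Rightarrow> real^'m) \<Rightarrow>
     ('m::finite) inputs" where
  "control_inputs T NT NC nj e Ad Ac c \<theta> w lam =
     \<lparr> in_step = time_step T NT,
       in_param = (\<lambda>k. \<theta> (e k)),
       in_pulse = (\<lambda>j i n. time_deriv T i (control_pulse nj c \<theta> j) (grid_time T NT n)),
       in_pulse_deriv = (\<lambda>j i n k.
         scalar_pderiv (\<lambda>\<theta>'. time_deriv T i (control_pulse nj c \<theta>' j) (grid_time T NT n)) \<theta> (e k)),
       in_matrix = control_matrix T NT NC nj e Ad Ac c \<theta>,
       in_state = w,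
       in_adjoint = lam \<rparr>"

end

theory Submission
  imports Defs
begin

text \<open>
  The system matrix is affine in \<open>\<theta>\<close>, and the partial derivative of its \<open>i\<close>-th time derivative with
  respect to \<open>\<theta>\<^sub>k\<close> is a combination of the control matrices \<open>A\<^sub>c\<^sub>,\<^sub>j\<close> whose coefficients are the free
  scalars \<open>g = \<partial>c\<^sub>j\<^sup>(\<^sup>i\<^sup>)(t\<^sub>n)/\<partial>\<theta>\<^sub>k\<close>.  Differentiating the recursion for \<open>D\<^sub>n\<^sub>,\<^sub>m w\<close> shows that
  \<open>(\<partial>D\<^sub>n\<^sub>,\<^sub>m/\<partial>\<theta>\<^sub>k) w\<close> is linear in these scalars: it equals \<open>\<Sum>\<^sub>j\<^sub>,\<^sub>i g V\<close> with vectors \<open>V\<close> depending on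
  \<open>n\<close>, \<open>m\<close>, \<open>j\<close>, \<open>i\<close> but not on \<open>k\<close>.  All matrix-vector products are spent on the \<open>V\<close>; a further
  parameter only costs additional scalar operations.
\<close>

section \<open>Time and parameter derivatives of the system matrix\<close>

lemma time_deriv_add_sum_scaleR:
  fixes B :: "'a::real_normed_vector" and V :: "'k \<Rightarrow> 'a" and f :: "'k \<Rightarrow> real \<Rightarrow> real"
  assumes "T > 0" and diff: "\<And>k. k \<in> K \<Longrightarrow> times_differentiable T m (f k)"
    and "i \<le> m" "t \<in> {0..T}"
  shows "time_deriv T i (\<lambda>t. B + (\<Sum>k\<in>K. f k t *\<^sub>R V k)) t =
    (if i = 0 then B else 0) + (\<Sum>k\<in>K. time_deriv T i (f k) t *\<^sub>R V k)"
  using assms(3,4)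
proof (induction i arbitrary: t)
  case 0
  then show ?case by simp
next
  case (Suc i)
  let ?h = "\<lambda>t. (if i = 0 then B else 0) + (\<Sum>k\<in>K. time_deriv T i (f k) t *\<^sub>R V k)"
  have "(time_deriv T i (f k) has_vector_derivative time_deriv T (Suc i) (f k) t)
      (at t within {0..T})" if "k \<in> K" for k
    using diff[OF that] Suc.prems by (auto simp: times_differentiable_def vector_derivative_works)
  then have "(?h has_vector_derivative (\<Sum>k\<in>K. time_deriv T (Suc i) (f k) t *\<^sub>R V k))
      (at t within {0..T})"
    by (auto intro!: derivative_eq_intros simp: has_real_derivative_iff_has_vector_derivative)
  then have "(time_deriv T i (\<lambda>t. B + (\<Sum>k\<in>K. f k t *\<^sub>R V k)) has_vector_derivative
      (\<Sum>k\<in>K. time_deriv T (Suc i) (f k) t *\<^sub>R V k)) (at t within {0..T})"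
    using has_vector_derivative_transform[OF Suc.prems(2) Suc.IH] Suc.prems(1) by simp
  from vector_derivative_within_cbox[unfolded box_real, OF \<open>T > 0\<close> Suc.prems(2) this]
  show ?case by simp
qed

context
  fixes T t :: real and NC m i :: nat and nj :: "nat \<Rightarrow> nat" and c :: "nat \<Rightarrow> nat \<Rightarrow> real \<Rightarrow> real"
  assumes T_pos: "T > 0" and t_mem: "t \<in> {0..T}" and i_le: "i \<le> m"
    and diff: "\<And>j k. j \<in> {1..NC} \<Longrightarrow> k \<in> {1..nj j} \<Longrightarrow> times_differentiable T m (c j k)"
begin

lemma time_deriv_control_pulse:
  assumes "j \<in> {1..NC}"
  shows "time_deriv T i (control_pulse nj c \<theta> j) t =
    (\<Sum>k=1..nj j. \<theta> (j, k) * time_deriv T i (c j k) t)"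
  using time_deriv_add_sum_scaleR[where K = "{1..nj j}" and f = "c j" and B = 0
      and V = "\<lambda>k. \<theta> (j, k)", OF T_pos diff[OF assms] i_le t_mem]
  by (simp add: control_pulse_def[abs_def] mult.commute)

lemma time_deriv_system_matrix:
  "time_deriv T i (system_matrix NC nj Ad Ac c \<theta>) t =
    (if i = 0 then Ad else 0) + (\<Sum>j=1..NC. time_deriv T i (control_pulse nj c \<theta> j) t *\<^sub>R Ac j)"
proof -
  let ?S = "SIGMA j:{1..NC}. {1..nj j}"
  have affine: "system_matrix NC nj Ad Ac c \<theta> =
      (\<lambda>t. Ad + (\<Sum>(j, k)\<in>?S. c j k t *\<^sub>R \<theta> (j, k) *\<^sub>R Ac j))"
    by (simp add: system_matrix_def control_pulse_def scaleR_sum_left sum.Sigma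
        mult.commute fun_eq_iff)
  have "time_deriv T i (system_matrix NC nj Ad Ac c \<theta>) t =
      (if i = 0 then Ad else 0) + (\<Sum>(j, k)\<in>?S. time_deriv T i (c j k) t *\<^sub>R \<theta> (j, k) *\<^sub>R Ac j)"
    unfolding affine case_prod_unfold using diff
    by (subst time_deriv_add_sum_scaleR[OF T_pos _ i_le t_mem]) auto
  also have "(\<Sum>(j, k)\<in>?S. time_deriv T i (c j k) t *\<^sub>R \<theta> (j, k) *\<^sub>R Ac j) =
      (\<Sum>j=1..NC. time_deriv T i (control_pulse nj c \<theta> j) t *\<^sub>R Ac j)"
    by (simp add: sum.Sigma[symmetric] time_deriv_control_pulse scaleR_sum_left mult.commute)
  finally show ?thesis .
qed

lemma time_deriv_control_pulse_has_scalar_pderiv: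
  assumes "j \<in> {1..NC}"
  shows "((\<lambda>x. time_deriv T i (control_pulse nj c (\<theta>(\<kappa> := x)) j) t) has_real_derivative
    scalar_pderiv (\<lambda>\<theta>'. time_deriv T i (control_pulse nj c \<theta>' j) t) \<theta> \<kappa>) (at (\<theta> \<kappa>))"
proof -
  have "((\<lambda>x. (\<theta>(\<kappa> := x)) (j, k)) has_real_derivative (if \<kappa> = (j, k) then 1 else 0))
      (at (\<theta> \<kappa>))" for k
    by auto
  then have "((\<lambda>x. \<Sum>k=1..nj j. (\<theta>(\<kappa> := x)) (j, k) * time_deriv T i (c j k) t) has_real_derivative
      (\<Sum>k=1..nj j. (if \<kappa> = (j, k) then 1 else 0) * time_deriv T i (c j k) t)) (at (\<theta> \<kappa>))"
    by (intro DERIV_sum DERIV_cmult_right)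
  then show ?thesis
    unfolding time_deriv_control_pulse[OF assms] scalar_pderiv_def
    by (simp add: DERIV_imp_deriv)
qed

lemma time_deriv_system_matrix_has_param_deriv:
  "((\<lambda>x. time_deriv T i (system_matrix NC nj Ad Ac c (\<theta>(\<kappa> := x))) t) has_vector_derivative
    (\<Sum>j=1..NC. scalar_pderiv (\<lambda>\<theta>'. time_deriv T i (control_pulse nj c \<theta>' j) t) \<theta> \<kappa> *\<^sub>R Ac j))
    (at (\<theta> \<kappa>))"
proof -
  have "((\<lambda>x. (if i = 0 then Ad else 0) +
      (\<Sum>j=1..NC. time_deriv T i (control_pulse nj c (\<theta>(\<kappa> := x)) j) t *\<^sub>R Ac j))
    has_vector_derivative
    0 + (\<Sum>j=1..NC. time_deriv T i (control_pulse nj c (\<theta>(\<kappa> := \<theta> \<kappa>)) j) t *\<^sub>R 0 +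
      scalar_pderiv (\<lambda>\<theta>'. time_deriv T i (control_pulse nj c \<theta>' j) t) \<theta> \<kappa> *\<^sub>R Ac j))
    (at (\<theta> \<kappa>))"
    by (intro has_vector_derivative_add has_vector_derivative_const has_vector_derivative_sum
        has_vector_derivative_scaleR time_deriv_control_pulse_has_scalar_pderiv)
  then show ?thesis
    by (simp add: time_deriv_system_matrix)
qed

end


section \<open>Derivatives of the Hermite Runge-Kutta matrices\<close>

lemma bounded_bilinear_matrix_vector_mult:
  "bounded_bilinear ((*v) :: real^'n^'m \<Rightarrow> real^'n \<Rightarrow> real^'m)"
  unfolding bilinear_conv_bounded_bilinear[symmetric] bilinear_def
  by (auto intro!: linearI simp: algebra_simps scaleR_matrix_vector_assoc)

lemmas matrix_vector_mult_sum_left =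
  bounded_bilinear.sum_left[OF bounded_bilinear_matrix_vector_mult]
lemmas matrix_vector_mult_sum_right =
  bounded_bilinear.sum_right[OF bounded_bilinear_matrix_vector_mult]

lemma matrix_pderiv_mult_vec:
  assumes deriv: "\<And>x. ((\<lambda>\<xi>. F (\<theta>(k := \<xi>)) *v x) has_vector_derivative V x) (at (\<theta> k))"
  shows "matrix_pderiv F \<theta> k *v x = V x"
proof -
  have entry: "((\<lambda>\<xi>. F (\<theta>(k := \<xi>)) $ r $ s) has_real_derivative V (axis s 1) $ r)
      (at (\<theta> k))" for r s
    using bounded_linear.has_vector_derivative[OF bounded_linear_vec_nth[of r] deriv[of "axis s 1"]]
    by (simp add: matrix_vector_mult_basis column_def has_real_derivative_iff_has_vector_derivative)
  then have "matrix_pderiv F \<theta> k $ r $ s = V (axis s 1) $ r" for r s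
    by (simp add: matrix_pderiv_def scalar_pderiv_def DERIV_imp_deriv)
  with entry have "((\<lambda>\<xi>. (F (\<theta>(k := \<xi>)) *v x) $ r) has_real_derivative
      (matrix_pderiv F \<theta> k *v x) $ r) (at (\<theta> k))" for r
    by (auto simp: matrix_vector_mult_def intro!: derivative_eq_intros)
  moreover have "((\<lambda>\<xi>. (F (\<theta>(k := \<xi>)) *v x) $ r) has_real_derivative V x $ r) (at (\<theta> k))" for r
    using bounded_linear.has_vector_derivative[OF bounded_linear_vec_nth deriv]
    by (simp add: has_real_derivative_iff_has_vector_derivative)
  ultimately show ?thesis
    by (auto simp: vec_eq_iff dest: DERIV_unique)
qed

text \<open>
  If \<open>S i\<close> is the \<open>i\<close>-th derivative of \<open>A\<close> at \<open>t\<close>, then this is the \<open>j\<close>-th derivative at \<open>t\<close> of the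
  solution of \<open>w' = A w\<close> with \<open>w(t) = x\<close>.
\<close>

fun solution_deriv :: "(nat \<Rightarrow> real^'m^'m) \<Rightarrow> real^'m \<Rightarrow> nat \<Rightarrow> real^'m" where
  "solution_deriv S x 0 = x"
| "solution_deriv S x (Suc j) =
     (\<Sum>l\<le>j. real (j choose l) *\<^sub>R (S (j - l) *v solution_deriv S x l))"

fun solution_deriv_variation ::
  "(nat \<Rightarrow> real^'m^'m) \<Rightarrow> (nat \<Rightarrow> real^'m^'m) \<Rightarrow> real^'m \<Rightarrow> nat \<Rightarrow> real^'m" where
  "solution_deriv_variation S B x 0 = 0"
| "solution_deriv_variation S B x (Suc j) = (\<Sum>l\<le>j. real (j choose l) *\<^sub>R
     (B (j - l) *v solution_deriv S x l + S (j - l) *v solution_deriv_variation S B x l))"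

lemma hrk_D_mult_vec: "hrk_D T A t j *v x = solution_deriv (\<lambda>i. time_deriv T i A t) x j"
proof (induction j rule: less_induct)
  case (less j)
  then show ?case
    by (cases j) (auto simp: matrix_vector_mult_sum_left scaleR_matrix_vector_assoc[symmetric]
        matrix_vector_mul_assoc[symmetric] intro!: sum.cong)
qed

lemma solution_deriv_has_vector_derivative:
  assumes "\<And>i. i < j \<Longrightarrow> ((\<lambda>\<xi>. S \<xi> i) has_vector_derivative B i) (at \<xi> within U)"
  shows "((\<lambda>\<xi>. solution_deriv (S \<xi>) x j) has_vector_derivative
    solution_deriv_variation (S \<xi>) B x j) (at \<xi> within U)"
  using assms
proof (induction j rule: less_induct)
  case (less j)
  show ?case
  proof (cases j)
    case 0
    then show ?thesis by simp
  next
    case (Suc k)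
    have "((\<lambda>\<xi>. S \<xi> (k - l) *v solution_deriv (S \<xi>) x l) has_vector_derivative
        S \<xi> (k - l) *v solution_deriv_variation (S \<xi>) B x l + B (k - l) *v solution_deriv (S \<xi>) x l)
        (at \<xi> within U)" if "l \<le> k" for l
      using that less Suc
      by (intro bounded_bilinear.has_vector_derivative[OF bounded_bilinear_matrix_vector_mult]) auto
    then show ?thesis
      by (auto simp: Suc add.commute intro!: derivative_eq_intros)
  qed
qed

lemma solution_deriv_variation_sum:
  "solution_deriv_variation S (\<lambda>i. \<Sum>c\<in>C. a c *\<^sub>R B c i) x j =
    (\<Sum>c\<in>C. a c *\<^sub>R solution_deriv_variation S (B c) x j)"
proof (induction j rule: less_induct)
  case (less j)
  show ?case
  proof (cases j)
    case 0
    then show ?thesis by simp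
  next
    case (Suc k)
    let ?y = "solution_deriv S x" and ?z = "\<lambda>c. solution_deriv_variation S (B c) x"
    have "solution_deriv_variation S (\<lambda>i. \<Sum>c\<in>C. a c *\<^sub>R B c i) x j =
        (\<Sum>l\<le>k. real (k choose l) *\<^sub>R
          ((\<Sum>c\<in>C. a c *\<^sub>R B c (k - l)) *v ?y l + S (k - l) *v (\<Sum>c\<in>C. a c *\<^sub>R ?z c l)))"
      using less Suc by simp
    also have "\<dots> = (\<Sum>l\<le>k. \<Sum>c\<in>C. a c *\<^sub>R real (k choose l) *\<^sub>R
          (B c (k - l) *v ?y l + S (k - l) *v ?z c l))"
      by (simp add: matrix_vector_mult_sum_left matrix_vector_mult_sum_right
          matrix_vector_mult_scaleR scaleR_matrix_vector_assoc[symmetric] scaleR_sum_right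
          scaleR_add_right sum.distrib mult.commute)
    also have "\<dots> = (\<Sum>c\<in>C. a c *\<^sub>R ?z c j)"
      by (subst sum.swap) (simp add: Suc scaleR_sum_right)
    finally show ?thesis .
  qed
qed

lemma matrix_pderiv_sum_hrk_D_mult_vec:
  fixes A :: "('k \<Rightarrow> real) \<Rightarrow> real \<Rightarrow> real^'m^'m" and X :: "'c \<Rightarrow> real^'m^'m"
  assumes deriv: "\<And>i. i < m \<Longrightarrow> ((\<lambda>\<xi>. time_deriv T i (A (\<theta>(\<kappa> := \<xi>))) t) has_vector_derivative
      (\<Sum>c\<in>C. g c i *\<^sub>R X c)) (at (\<theta> \<kappa>))"
    and J_le: "\<And>j. j \<in> J \<Longrightarrow> j \<le> m"
  shows "matrix_pderiv (\<lambda>\<theta>'. \<Sum>j\<in>J. a j *\<^sub>R hrk_D T (A \<theta>') t j) \<theta> \<kappa> *v x =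
    (\<Sum>c\<in>C. \<Sum>i<m. g c i *\<^sub>R (\<Sum>j\<in>J. a j *\<^sub>R
      solution_deriv_variation (\<lambda>i. time_deriv T i (A \<theta>) t) ((\<lambda>_. 0)(i := X c)) x j))"
proof -
  let ?S = "\<lambda>\<theta> i. time_deriv T i (A \<theta>) t"
  let ?B = "\<lambda>i. \<Sum>(c, l)\<in>C \<times> {..<m}. g c l *\<^sub>R ((\<lambda>_. 0)(l := X c)) i"
  have "((\<lambda>\<xi>. solution_deriv (?S (\<theta>(\<kappa> := \<xi>))) x j) has_vector_derivative
      solution_deriv_variation (?S \<theta>) ?B x j) (at (\<theta> \<kappa>))" if "j \<in> J" for j x
  proof -
    have "?B i = (\<Sum>c\<in>C. g c i *\<^sub>R X c)" if "i < m" for i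
      using that
      by (simp add: sum.cartesian_product[symmetric] fun_upd_def if_distrib[of "scaleR _"] sum.delta
          cong: if_cong)
    then have "((\<lambda>\<xi>. ?S (\<theta>(\<kappa> := \<xi>)) i) has_vector_derivative ?B i) (at (\<theta> \<kappa>))" if "i < j" for i
      using deriv that J_le[OF \<open>j \<in> J\<close>] by simp
    from solution_deriv_has_vector_derivative[OF this] show ?thesis by simp
  qed
  then have "((\<lambda>\<xi>. (\<Sum>j\<in>J. a j *\<^sub>R hrk_D T (A (\<theta>(\<kappa> := \<xi>))) t j) *v x) has_vector_derivative
      (\<Sum>j\<in>J. a j *\<^sub>R solution_deriv_variation (?S \<theta>) ?B x j)) (at (\<theta> \<kappa>))" for x
    by (auto simp: matrix_vector_mult_sum_left scaleR_matrix_vector_assoc[symmetric] hrk_D_mult_vec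
        intro!: derivative_eq_intros)
  then have "matrix_pderiv (\<lambda>\<theta>'. \<Sum>j\<in>J. a j *\<^sub>R hrk_D T (A \<theta>') t j) \<theta> \<kappa> *v x =
      (\<Sum>j\<in>J. a j *\<^sub>R solution_deriv_variation (?S \<theta>) ?B x j)"
    by (rule matrix_pderiv_mult_vec)
  also have "\<dots> = (\<Sum>j\<in>J. \<Sum>(c, i)\<in>C \<times> {..<m}. g c i *\<^sub>R a j *\<^sub>R
      solution_deriv_variation (?S \<theta>) ((\<lambda>_. 0)(i := X c)) x j)"
    by (simp add: fun_upd_def case_prod_unfold solution_deriv_variation_sum
        scaleR_sum_right mult.commute)
  also have "\<dots> = (\<Sum>(c, i)\<in>C \<times> {..<m}. g c i *\<^sub>R (\<Sum>j\<in>J. a j *\<^sub>R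
      solution_deriv_variation (?S \<theta>) ((\<lambda>_. 0)(i := X c)) x j))"
    by (subst sum.swap) (simp add: scaleR_sum_right case_prod_unfold)
  finally show ?thesis
    by (simp add: sum.cartesian_product)
qed


section \<open>Computable vectors\<close>

abbreviation exec :: "('m::finite) inputs \<Rightarrow> instr list \<Rightarrow> (nat \<Rightarrow> real) \<times> (nat \<Rightarrow> real^'m) \<Rightarrow>
    (nat \<Rightarrow> real) \<times> (nat \<Rightarrow> real^'m)" where
  "exec D P \<equiv> fold (exec_instr D) P"

lemma valid_program_append [simp]:
  "valid_program p q NT NC NP (P @ Q) \<longleftrightarrow>
    valid_program p q NT NC NP P \<and> valid_program p q NT NC NP Q"
  by (auto simp: valid_program_def)

lemma matvec_count_append [simp]: "matvec_count (P @ Q) = matvec_count P + matvec_count Q"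
  by (simp add: matvec_count_def)

lemma valid_program_mono:
  assumes "valid_program p q NT NC NP P" "NP \<le> NP'"
  shows "valid_program p q NT NC NP' P"
proof -
  have "valid_matrix_ref p q NT NC NP' X" if "valid_matrix_ref p q NT NC NP X" for X
    using that \<open>NP \<le> NP'\<close> by (cases X) auto
  then have "valid_instr p q NT NC NP' I" if "valid_instr p q NT NC NP I" for I
    using that \<open>NP \<le> NP'\<close> by (cases I) auto
  with assms(1) show ?thesis
    by (auto simp: valid_program_def)
qed

text \<open>Scalar register \<open>0\<close> is not an output and serves as scratch space.\<close>

definition agree_below :: "nat \<Rightarrow> (nat \<Rightarrow> real) \<times> (nat \<Rightarrow> 'v) \<Rightarrow> (nat \<Rightarrow> real) \<times> (nat \<Rightarrow> 'v) \<Rightarrow> bool" where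
  "agree_below d \<sigma> \<sigma>' \<longleftrightarrow> (\<forall>r>0. fst \<sigma> r = fst \<sigma>' r) \<and> (\<forall>r<d. snd \<sigma> r = snd \<sigma>' r)"

context
  fixes p q NT NC :: nat
begin

text \<open>
  Validity is demanded for zero parameters, so that neither the program nor its cost can depend on
  the number of parameters.
\<close>

definition vec_computable :: "(('m::finite) inputs \<Rightarrow> real^'m) \<Rightarrow> bool" where
  "vec_computable F \<longleftrightarrow> (\<exists>P. \<forall>d. valid_program p q NT NC 0 (P d) \<and>
     (\<forall>D \<sigma>. snd (exec D (P d) \<sigma>) d = F D \<and> agree_below d \<sigma> (exec D (P d) \<sigma>)))"

lemma vec_computableE:
  assumes "vec_computable F"
  obtains P where "\<And>d. valid_program p q NT NC 0 (P d)"
    "\<And>d D \<sigma>. snd (exec D (P d) \<sigma>) d = F D \<and> agree_below d \<sigma> (exec D (P d) \<sigma>)"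
  using assms unfolding vec_computable_def by blast

lemma vec_computable_extend:
  assumes "vec_computable F"
    and Q: "\<And>d. valid_program p q NT NC 0 (Q d)"
      "\<And>d D \<sigma>. snd \<sigma> d = F D \<Longrightarrow>
        snd (exec D (Q d) \<sigma>) d = G D \<and> agree_below d \<sigma> (exec D (Q d) \<sigma>)"
  shows "vec_computable G"
proof -
  obtain P where P: "\<And>d. valid_program p q NT NC 0 (P d)"
    "\<And>d D \<sigma>. snd (exec D (P d) \<sigma>) d = F D \<and> agree_below d \<sigma> (exec D (P d) \<sigma>)"
    using vec_computableE[OF assms(1)] by blast
  have "snd (exec D (P d @ Q d) \<sigma>) d = G D \<and> agree_below d \<sigma> (exec D (P d @ Q d) \<sigma>)" for d D \<sigma>
    using P(2)[of D d \<sigma>] Q(2)[of "exec D (P d) \<sigma>" d D] by (simp add: agree_below_def)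
  with P(1) Q(1) show ?thesis
    unfolding vec_computable_def by (intro exI[of _ "\<lambda>d. P d @ Q d"]) simp
qed

lemma vec_computable_zero: "vec_computable (\<lambda>D. 0)"
  unfolding vec_computable_def
  by (rule exI[of _ "\<lambda>d. [Load_Const 0 0, Vec_Scale d 0 d]"])
    (auto simp: valid_program_def agree_below_def)

lemma vec_computable_state: "n \<le> NT \<Longrightarrow> vec_computable (\<lambda>D. in_state D n)"
  unfolding vec_computable_def
  by (rule exI[of _ "\<lambda>d. [Load_State d n]"]) (auto simp: valid_program_def agree_below_def)

lemma vec_computable_scaleR: "vec_computable F \<Longrightarrow> vec_computable (\<lambda>D. a *\<^sub>R F D)"
  by (erule vec_computable_extend[where Q = "\<lambda>d. [Load_Const 0 a, Vec_Scale d 0 d]"])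
    (auto simp: valid_program_def agree_below_def)

lemma vec_computable_uminus: "vec_computable F \<Longrightarrow> vec_computable (\<lambda>D. - F D)"
  using vec_computable_scaleR[of F "-1"] by simp

lemma vec_computable_scaleR_step: "vec_computable F \<Longrightarrow> vec_computable (\<lambda>D. in_step D *\<^sub>R F D)"
  by (erule vec_computable_extend[where Q = "\<lambda>d. [Load_Step 0, Vec_Scale d 0 d]"])
    (auto simp: valid_program_def agree_below_def)

lemma vec_computable_scaleR_step_power:
  assumes "vec_computable F"
  shows "vec_computable (\<lambda>D. in_step D ^ j *\<^sub>R F D)"
proof (induction j)
  case 0
  then show ?case using assms by simp
next
  case (Suc j)
  then show ?case using vec_computable_scaleR_step by fastforce
qed

lemma vec_computable_mat_vec:
  "vec_computable F \<Longrightarrow> valid_matrix_ref p q NT NC 0 X \<Longrightarrow>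
    vec_computable (\<lambda>D. in_matrix D X *v F D)"
  by (erule vec_computable_extend[where Q = "\<lambda>d. [Mat_Vec d X d]"])
    (auto simp: valid_program_def agree_below_def)

lemma vec_computable_add:
  assumes "vec_computable F" "vec_computable G"
  shows "vec_computable (\<lambda>D. F D + G D)"
proof -
  obtain P where P: "\<And>d. valid_program p q NT NC 0 (P d)"
    "\<And>d D \<sigma>. snd (exec D (P d) \<sigma>) d = G D \<and> agree_below d \<sigma> (exec D (P d) \<sigma>)"
    using vec_computableE[OF assms(2)] by blast
  have "snd (exec D (P (Suc d) @ [Vec_Add d d (Suc d)]) \<sigma>) d = F D + G D \<and>
      agree_below d \<sigma> (exec D (P (Suc d) @ [Vec_Add d d (Suc d)]) \<sigma>)" if "snd \<sigma> d = F D" for d D \<sigma>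
    using that P(2)[of D "Suc d" \<sigma>] by (cases "exec D (P (Suc d)) \<sigma>") (auto simp: agree_below_def)
  moreover have "valid_program p q NT NC 0 (P (Suc d) @ [Vec_Add d d (Suc d)])" for d
    using P(1) by (simp add: valid_program_def)
  ultimately show ?thesis
    by (intro vec_computable_extend[OF assms(1), where Q = "\<lambda>d. P (Suc d) @ [Vec_Add d d (Suc d)]"])
qed

lemma vec_computable_sum:
  "(\<And>i. i \<in> I \<Longrightarrow> vec_computable (F i)) \<Longrightarrow> vec_computable (\<lambda>D. \<Sum>i\<in>I. F i D)"
  by (induction I rule: infinite_finite_induct) (auto intro: vec_computable_zero vec_computable_add)

lemma vec_computable_solution_deriv:
  assumes "\<And>i F. i < j \<Longrightarrow> vec_computable F \<Longrightarrow> vec_computable (\<lambda>D. S D i *v F D)"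
    and "vec_computable X"
  shows "vec_computable (\<lambda>D. solution_deriv (S D) (X D) j)"
  using assms(1)
proof (induction j rule: less_induct)
  case (less j)
  then show ?case
    by (cases j) (auto intro!: vec_computable_sum vec_computable_scaleR simp: assms(2))
qed

lemma vec_computable_solution_deriv_variation:
  assumes "\<And>i F. i < j \<Longrightarrow> vec_computable F \<Longrightarrow> vec_computable (\<lambda>D. S D i *v F D)"
    and "\<And>i F. i < j \<Longrightarrow> vec_computable F \<Longrightarrow> vec_computable (\<lambda>D. B D i *v F D)"
    and "vec_computable X"
  shows "vec_computable (\<lambda>D. solution_deriv_variation (S D) (B D) (X D) j)"
  using assms(1,2)
proof (induction j rule: less_induct)
  case (less j)
  show ?case
  proof (cases j)
    case 0
    then show ?thesis by (simp add: vec_computable_zero)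
  next
    case (Suc k)
    have "vec_computable (\<lambda>D. solution_deriv (S D) (X D) l)"
      "vec_computable (\<lambda>D. solution_deriv_variation (S D) (B D) (X D) l)" if "l \<le> k" for l
      using that less Suc assms(3) by (auto intro!: vec_computable_solution_deriv)
    then show ?thesis
      using less.prems Suc
      by (auto intro!: vec_computable_sum vec_computable_scaleR vec_computable_add)
  qed
qed


section \<open>Accumulation over the parameters\<close>

definition accumulation_program ::
  "nat \<Rightarrow> nat \<Rightarrow> (('m::finite) inputs \<Rightarrow> nat \<Rightarrow> real) \<Rightarrow> instr list \<Rightarrow> bool" where
  "accumulation_program M NP f P \<longleftrightarrow> valid_program p q NT NC NP P \<and> matvec_count P \<le> M \<and>
     (\<forall>D \<sigma>. \<forall>k\<in>{1..NP}. fst (exec D P \<sigma>) k = fst \<sigma> k + f D k)"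

definition accumulable :: "(('m::finite) inputs \<Rightarrow> nat \<Rightarrow> real) \<Rightarrow> bool" where
  "accumulable f \<longleftrightarrow> (\<exists>M. \<forall>NP. \<exists>P. accumulation_program M NP f P)"

lemma accumulation_program_append:
  "accumulation_program M NP f P \<Longrightarrow> accumulation_program N NP g Q \<Longrightarrow>
    accumulation_program (M + N) NP (\<lambda>D k. f D k + g D k) (P @ Q)"
  by (simp add: accumulation_program_def add_mono del: split_paired_All)

lemma accumulable_zero: "accumulable (\<lambda>D k. 0)"
  unfolding accumulable_def accumulation_program_def
  by (intro exI[of _ 0] allI exI[of _ "[]"]) (auto simp: valid_program_def matvec_count_def)

lemma accumulable_add: "accumulable f \<Longrightarrow> accumulable g \<Longrightarrow> accumulable (\<lambda>D k. f D k + g D k)"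
  unfolding accumulable_def by (blast intro: accumulation_program_append)

lemma accumulable_sum:
  "(\<And>i. i \<in> I \<Longrightarrow> accumulable (f i)) \<Longrightarrow> accumulable (\<lambda>D k. \<Sum>i\<in>I. f i D k)"
  by (induction I rule: infinite_finite_induct) (auto intro: accumulable_zero accumulable_add)

text \<open>Scalar register \<open>a\<close> holds the common factor.\<close>

fun scatter_program :: "nat \<Rightarrow> nat \<Rightarrow> nat \<Rightarrow> nat \<Rightarrow> nat \<Rightarrow> instr list" where
  "scatter_program j i n a 0 = []"
| "scatter_program j i n a (Suc K) = scatter_program j i n a K @
     [Load_Pulse_Deriv 0 j i n (Suc K), Scalar_Mult 0 0 a, Scalar_Add (Suc K) (Suc K) 0]"

lemma exec_scatter_program:
  assumes "K < a" "k > 0"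
  shows "fst (exec D (scatter_program j i n a K) \<sigma>) k =
    fst \<sigma> k + (if k \<le> K then in_pulse_deriv D j i n k * fst \<sigma> a else 0)"
  using assms
proof (induction K arbitrary: k)
  case 0
  then show ?case by simp
next
  case (Suc K)
  have "fst (exec D (scatter_program j i n a K) \<sigma>) a = fst \<sigma> a"
    using Suc.IH[of a] Suc.prems by simp
  then show ?case
    using Suc.IH[of k] Suc.prems
    by (cases "exec D (scatter_program j i n a K) \<sigma>") (auto simp: le_Suc_eq)
qed

lemma valid_scatter_program:
  assumes "j \<in> {1..NC}" "i < max p q" "n \<le> NT" "K \<le> NP"
  shows "valid_program p q NT NC NP (scatter_program j i n a K)"
  using assms by (induction K) (auto simp: valid_program_def)

lemma matvec_count_scatter_program: "matvec_count (scatter_program j i n a K) = 0"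
  by (induction K) (auto simp: matvec_count_def)

text \<open>The inner product is kept in the first scalar register after the outputs.\<close>

definition inner_scatter_program :: "nat \<Rightarrow> nat \<Rightarrow> nat \<Rightarrow> nat \<Rightarrow> nat \<Rightarrow> instr list" where
  "inner_scatter_program j i n n' NP =
     [Load_Adjoint 1 n', Inner_Prod (Suc NP) 0 1] @ scatter_program j i n (Suc NP) NP"

lemma exec_inner_scatter_program:
  assumes "k \<in> {1..NP}"
  shows "fst (exec D (inner_scatter_program j i n n' NP) \<sigma>) k =
    fst \<sigma> k + in_pulse_deriv D j i n k * (snd \<sigma> 0 \<bullet> in_adjoint D n')"
  using assms by (cases \<sigma>) (simp add: inner_scatter_program_def exec_scatter_program)

lemma valid_inner_scatter_program:
  assumes "j \<in> {1..NC}" "i < max p q" "n \<le> NT" "n' \<in> {1..NT}"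
  shows "valid_program p q NT NC NP (inner_scatter_program j i n n' NP)"
  using assms valid_scatter_program[of j i n NP NP]
  by (simp add: inner_scatter_program_def valid_program_def)

lemma matvec_count_inner_scatter_program: "matvec_count (inner_scatter_program j i n n' NP) = 0"
  using matvec_count_scatter_program by (simp add: inner_scatter_program_def matvec_count_def)

lemma accumulable_pulse_deriv_inner:
  fixes F :: "('m::finite) inputs \<Rightarrow> real^'m"
  assumes "vec_computable F" "j \<in> {1..NC}" "i < max p q" "n \<le> NT" "n' \<in> {1..NT}"
  shows "accumulable (\<lambda>D k. in_pulse_deriv D j i n k * (F D \<bullet> in_adjoint D n'))"
proof -
  obtain P where P: "\<And>d. valid_program p q NT NC 0 (P d)"
    "\<And>d D \<sigma>. snd (exec D (P d) \<sigma>) d = F D \<and> agree_below d \<sigma> (exec D (P d) \<sigma>)"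
    using vec_computableE[OF assms(1)] by blast
  have "accumulation_program (matvec_count (P 0)) NP
      (\<lambda>D k. in_pulse_deriv D j i n k * (F D \<bullet> in_adjoint D n'))
      (P 0 @ inner_scatter_program j i n n' NP)" (is "accumulation_program _ _ _ ?Q") for NP
    unfolding accumulation_program_def
  proof (intro conjI allI ballI)
    show "valid_program p q NT NC NP ?Q"
      using valid_program_mono[OF P(1)[of 0]] valid_inner_scatter_program[OF assms(2-5)] by simp
    show "matvec_count ?Q \<le> matvec_count (P 0)"
      by (simp add: matvec_count_inner_scatter_program)
    fix D :: "'m inputs" and \<sigma> k
    assume "k \<in> {1..NP}"
    then show "fst (exec D ?Q \<sigma>) k = fst \<sigma> k + in_pulse_deriv D j i n k * (F D \<bullet> in_adjoint D n')"
      using P(2)[of D 0 \<sigma>] by (simp add: exec_inner_scatter_program agree_below_def)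
  qed
  then show ?thesis
    unfolding accumulable_def by blast
qed

lemma accumulable_program_output:
  assumes "accumulable f"
  obtains M where "\<And>NP. \<exists>P. valid_program p q NT NC NP P \<and> matvec_count P \<le> M \<and>
    (\<forall>D. \<forall>k\<in>{1..NP}. program_output D P k = f D k)"
proof -
  have "valid_program p q NT NC NP P \<and> matvec_count P \<le> M \<and>
      (\<forall>D. \<forall>k\<in>{1..NP}. program_output D P k = f D k)" if "accumulation_program M NP f P" for M NP P
    using that by (simp add: accumulation_program_def program_output_def run_def)
  with assms that show thesis
    unfolding accumulable_def by meson
qed

end


section \<open>The gradient accumulation\<close>

definition control_variation ::
  "nat \<Rightarrow> (nat \<Rightarrow> real) \<Rightarrow> nat \<Rightarrow> nat \<Rightarrow> nat \<Rightarrow> ('m::finite) inputs \<Rightarrow> real^'m" where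
  "control_variation r a n j i D = (\<Sum>l=1..r. a l *\<^sub>R in_step D ^ l *\<^sub>R
     solution_deriv_variation (\<lambda>l. in_matrix D (Sys_Deriv l n))
       ((\<lambda>_. 0)(i := in_matrix D (Control j))) (in_state D n) l)"

lemma vec_computable_control_variation:
  assumes "n \<le> NT" "j \<in> {1..NC}" "r \<le> max p q"
  shows "vec_computable p q NT NC (control_variation r a n j i)"
  unfolding control_variation_def[abs_def]
proof (intro vec_computable_sum vec_computable_scaleR vec_computable_scaleR_step_power
    vec_computable_solution_deriv_variation vec_computable_state)
  fix l i' and F :: "'m inputs \<Rightarrow> real^'m"
  assume "l \<in> {1..r}" "i' < l" and F: "vec_computable p q NT NC F"
  then show "vec_computable p q NT NC (\<lambda>D. in_matrix D (Sys_Deriv i' n) *v F D)"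
    using assms by (intro vec_computable_mat_vec) auto
  show "vec_computable p q NT NC (\<lambda>D. ((\<lambda>_. 0)(i := in_matrix D (Control j))) i' *v F D)"
    using assms F by (cases "i' = i") (auto intro: vec_computable_zero vec_computable_mat_vec)
qed (use assms in simp)

lemma grid_time_mem:
  assumes "T \<ge> 0" "n \<le> NT"
  shows "grid_time T NT n \<in> {0..T}"
proof -
  have "real n * T \<le> real NT * T"
    using assms by (simp add: mult_right_mono)
  with assms show ?thesis
    by (cases "NT = 0") (auto simp: grid_time_def time_step_def field_simps)
qed

lemma matrix_pderiv_sum_hrk_D_mult_state:
  fixes Ad :: "real^'m^'m" and Ac :: "nat \<Rightarrow> real^'m^'m" and \<theta> :: "nat \<times> nat \<Rightarrow> real"
    and w lam :: "nat \<Rightarrow> real^'m" and e :: "nat \<Rightarrow> nat \<times> nat"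
  assumes "T > 0" "n \<le> NT" "r \<le> m"
    and diff: "\<And>j k. j \<in> {1..NC} \<Longrightarrow> k \<in> {1..nj j} \<Longrightarrow> times_differentiable T (m - 1) (c j k)"
  defines "D \<equiv> control_inputs T NT NC nj e Ad Ac c \<theta> w lam"
  shows "matrix_pderiv (\<lambda>\<theta>'. \<Sum>l=1..r. (a l * time_step T NT ^ l) *\<^sub>R
      hrk_D T (system_matrix NC nj Ad Ac c \<theta>') (grid_time T NT n) l) \<theta> (e k) *v w n =
    (\<Sum>j=1..NC. \<Sum>i<m. in_pulse_deriv D j i n k *\<^sub>R control_variation r a n j i D)"
proof -
  have "((\<lambda>x. time_deriv T i (system_matrix NC nj Ad Ac c (\<theta>(e k := x))) (grid_time T NT n))
      has_vector_derivative (\<Sum>j=1..NC. in_pulse_deriv D j i n k *\<^sub>R Ac j)) (at (\<theta> (e k)))"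
    if "i < m" for i
    unfolding D_def control_inputs_def inputs.select_convs
    by (rule time_deriv_system_matrix_has_param_deriv[where m = "m - 1"])
      (use that assms(1,2) diff in \<open>auto simp: grid_time_mem simp del: atLeastAtMost_iff\<close>)
  then show ?thesis
    by (subst matrix_pderiv_sum_hrk_D_mult_vec[where m = m])
      (use assms(3) in \<open>auto simp: control_variation_def D_def control_inputs_def\<close>)
qed

definition hrk_L_weight :: "nat \<Rightarrow> nat \<Rightarrow> nat \<Rightarrow> real" where
  "hrk_L_weight p q l = - ((-1) ^ l * hrk_coeff q p l / fact l)"

definition hrk_R_weight :: "nat \<Rightarrow> nat \<Rightarrow> nat \<Rightarrow> real" where
  "hrk_R_weight p q l = hrk_coeff p q l / fact l"

lemma hrk_L_eq_sum_weight:
  "hrk_L p q T NT A n =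
    (\<Sum>l=1..q. (hrk_L_weight p q l * time_step T NT ^ l) *\<^sub>R hrk_D T A (grid_time T NT n) l)"
  by (simp add: hrk_L_def hrk_L_weight_def sum_negf)

lemma hrk_R_eq_sum_weight:
  "hrk_R p q T NT A n =
    (\<Sum>l=1..p. (hrk_R_weight p q l * time_step T NT ^ l) *\<^sub>R hrk_D T A (grid_time T NT n) l)"
  by (simp add: hrk_R_def hrk_R_weight_def)

definition control_gradient ::
  "nat \<Rightarrow> nat \<Rightarrow> nat \<Rightarrow> nat \<Rightarrow> ('m::finite) inputs \<Rightarrow> nat \<Rightarrow> real" where
  "control_gradient p q NT NC D k = (\<Sum>n=0..NT - 1. \<Sum>j=1..NC. \<Sum>i<max p q.
     in_pulse_deriv D j i (n + 1) k *
       (- control_variation q (hrk_L_weight p q) (n + 1) j i D \<bullet> in_adjoint D (n + 1)) +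
     in_pulse_deriv D j i n k *
       (- control_variation p (hrk_R_weight p q) n j i D \<bullet> in_adjoint D (n + 1)))"

lemma accumulable_control_gradient:
  assumes "NT \<ge> 1"
  shows "accumulable p q NT NC (control_gradient p q NT NC)"
  unfolding control_gradient_def[abs_def]
  by (intro accumulable_sum accumulable_add accumulable_pulse_deriv_inner vec_computable_uminus
      vec_computable_control_variation) (use assms in auto)

lemma gradient_accumulation_eq_control_gradient:
  fixes Ad :: "real^'m^'m" and e :: "nat \<Rightarrow> nat \<times> nat"
  assumes "T > 0" "NT \<ge> 1"
    and diff: "\<And>j k. j \<in> {1..NC} \<Longrightarrow> k \<in> {1..nj j} \<Longrightarrow> times_differentiable T (max p q - 1) (c j k)"
  shows "gradient_accumulation p q T NT (system_matrix NC nj Ad Ac c) \<theta> w lam (e k) =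
    control_gradient p q NT NC (control_inputs T NT NC nj e Ad Ac c \<theta> w lam) k"
proof -
  let ?D = "control_inputs T NT NC nj e Ad Ac c \<theta> w lam" and ?A = "system_matrix NC nj Ad Ac c"
  have deriv_L: "matrix_pderiv (\<lambda>\<theta>'. hrk_L p q T NT (?A \<theta>') n) \<theta> (e k) *v w n =
      (\<Sum>j=1..NC. \<Sum>i<max p q.
        in_pulse_deriv ?D j i n k *\<^sub>R control_variation q (hrk_L_weight p q) n j i ?D)"
    if "n \<le> NT" for n
    unfolding hrk_L_eq_sum_weight
    by (rule matrix_pderiv_sum_hrk_D_mult_state) (use that assms(1,2) diff in auto)
  have deriv_R: "matrix_pderiv (\<lambda>\<theta>'. hrk_R p q T NT (?A \<theta>') n) \<theta> (e k) *v w n =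
      (\<Sum>j=1..NC. \<Sum>i<max p q.
        in_pulse_deriv ?D j i n k *\<^sub>R control_variation p (hrk_R_weight p q) n j i ?D)"
    if "n \<le> NT" for n
    unfolding hrk_R_eq_sum_weight
    by (rule matrix_pderiv_sum_hrk_D_mult_state) (use that assms(1,2) diff in auto)
  have adjoint: "in_adjoint ?D = lam"
    by (simp add: control_inputs_def)
  show ?thesis
    unfolding gradient_accumulation_def control_gradient_def sum_negf[symmetric]
  proof (rule sum.cong[OF refl])
    fix n assume "n \<in> {0..NT - 1}"
    then have "n \<le> NT" "n + 1 \<le> NT"
      using assms(2) by auto
    then show "- ((matrix_pderiv (\<lambda>\<theta>'. hrk_L p q T NT (?A \<theta>') (n + 1)) \<theta> (e k) *v w (n + 1) +
          matrix_pderiv (\<lambda>\<theta>'. hrk_R p q T NT (?A \<theta>') n) \<theta> (e k) *v w n) \<bullet> lam (n + 1)) =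
        (\<Sum>j=1..NC. \<Sum>i<max p q.
          in_pulse_deriv ?D j i (n + 1) k *
            (- control_variation q (hrk_L_weight p q) (n + 1) j i ?D \<bullet> in_adjoint ?D (n + 1)) +
          in_pulse_deriv ?D j i n k *
            (- control_variation p (hrk_R_weight p q) n j i ?D \<bullet> in_adjoint ?D (n + 1)))"
      by (simp add: deriv_L deriv_R adjoint inner_add_left inner_sum_left sum_subtractf sum_negf)
  qed
qed

theorem theorem2:
  fixes NT NC p q :: nat
  assumes "NT \<ge> 1" and "NC \<ge> 1" and "p + q \<ge> 1"
  shows "\<exists>M::nat. \<forall>(NP::nat) (nj :: nat \<Rightarrow> nat) (e :: nat \<Rightarrow> nat \<times> nat).
    NP \<ge> 1 \<longrightarrow> (\<Sum>j=1..NC. nj j) = NP \<longrightarrow>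
    bij_betw e {1..NP} (SIGMA j:{1..NC}. {1..nj j}) \<longrightarrow>
    (\<exists>P. valid_program p q NT NC NP P \<and> matvec_count P \<le> M \<and>
      (\<forall>(T::real) (Ad :: real^('n::finite + 'n)^('n + 'n)) (Ac :: nat \<Rightarrow> real^('n + 'n)^('n + 'n))
         (c :: nat \<Rightarrow> nat \<Rightarrow> real \<Rightarrow> real) (\<theta> :: nat \<times> nat \<Rightarrow> real)
         (w :: nat \<Rightarrow> real^('n + 'n)) (lam :: nat \<Rightarrow> real^('n + 'n)).
         T > 0 \<longrightarrow>
         (\<forall>j\<in>{1..NC}. \<forall>k\<in>{1..nj j}. times_differentiable T (max p q - 1) (c j k)) \<longrightarrow>
         (\<forall>k\<in>{1..NP}.
            program_output (control_inputs T NT NC nj e Ad Ac c \<theta> w lam) P k =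
            gradient_accumulation p q T NT (system_matrix NC nj Ad Ac c) \<theta> w lam (e k))))"
proof -
  obtain M where M: "\<And>NP. \<exists>P. valid_program p q NT NC NP P \<and> matvec_count P \<le> M \<and>
      (\<forall>(D :: ('n + 'n) inputs). \<forall>k\<in>{1..NP}. program_output D P k = control_gradient p q NT NC D k)"
    using accumulable_program_output[OF accumulable_control_gradient[OF assms(1)]] by blast
  show ?thesis
  proof (intro exI[of _ M] allI impI, goal_cases parameters)
    case (parameters NP nj e)
    obtain P where "valid_program p q NT NC NP P" "matvec_count P \<le> M"
      "\<And>k (D :: ('n + 'n) inputs).
        k \<in> {1..NP} \<Longrightarrow> program_output D P k = control_gradient p q NT NC D k"
      using M by blast
    then show ?case
      using assms(1)
      by (intro exI[of _ P] conjI allI impI ballI)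
        (auto intro!: gradient_accumulation_eq_control_gradient[symmetric])
  qed
qed

end
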